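(* Let $\Omega$ be the set of all Boolean functions, quasi-ordered by simple variable substitution $\leq$. Let $I\subseteq\Omega$ be an initial segment of $(\Omega,\leq)$. The following are equivalent: (i) $I$ is definable by finitely many functional equations; (ii) $I$ is definable by a single functional equation; (iii) $I=\mathrm{Forbid}(A):=\Omega\setminus\{g\in\Omega: a\leq g \text{ for some } a\in A\}$ for some finite antichain $A$ of $(\Omega,\leq)$.
   Context: $\mathbb{B}=\{0,1\}$. A Boolean function is a map $f:\mathbb{B}^n\to\mathbb{B}$ for some $n\geq 1$ (its arity); $\Omega=\bigcup_{n\geq1}\mathbb{B}^{\mathbb{B}^n}$. For $1\le i\le n$, the $n$-ary projection $e^n_i$ maps $(a_1,\dots,a_n)\mapsto a_i$. For an $n$-ary $f$ and an $m$-ary $g$, write $g\leq f$ if there are $m$-ary projections $p_1,\dots,p_n$ with $g=f(p_1,\dots,p_n)$ (i.e. $g$ is obtained from $f$ by identifying, permuting or adding variables). This is a quasi-order; an initial segment is a set $I$ with $g\le f\in I\Rightarrow g\in I$; an antichain is a set of pairwise $\leq$-incomparable elements. A functional equation is a formal expression $h_1(\mathbf f(g_1(\mathbf x_1,\dots,\mathbf x_p)),\dots,\mathbf f(g_m(\mathbf x_1,\dots,\mathbf x_p)))=h_2(\mathbf f(g'_1(\mathbf x_1,\dots,\mathbf x_p)),\dots,\mathbf f(g'_t(\mathbf x_1,\dots,\mathbf x_p)))$ with $m,t,p\ge1$, $h_1:\mathbb{B}^m\to\mathbb{B}$, $h_2:\mathbb{B}^t\to\mathbb{B}$, $g_i,g'_j:\mathbb{B}^p\to\mathbb{B}$.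 An $n$-ary $f$ satisfies it if the equality holds for all $\mathbf v_1,\dots,\mathbf v_p\in\mathbb{B}^n$, where $g_i(\mathbf v_1,\dots,\mathbf v_p)\in\mathbb{B}^n$ is computed componentwise. A class $K\subseteq\Omega$ is defined by a set of equations if $K$ is exactly the set of Boolean functions satisfying all of them. *)

theory Defs
  imports Main "HOL-Library.FuncSet"
begin

text \<open>
  A tuple in \<open>\<bool>^n\<close> is a list of length \<open>n\<close>, with coordinates numbered from 0.  Functions on
  \<open>\<bool>^n\<close> are extensional, so that HOL equality is equality of functions.
\<close>

definition cube :: "nat \<Rightarrow> bool list set" where
  "cube n = {xs. length xs = n}"

definition n_ary :: "nat \<Rightarrow> (bool list \<Rightarrow> bool) set" where
  "n_ary n = cube n \<rightarrow>\<^sub>E (UNIV :: bool set)"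

text \<open>A Boolean function is paired with its arity: functions of different arities are distinct.\<close>

type_synonym boolfun = "nat \<times> (bool list \<Rightarrow> bool)"

definition Omega :: "boolfun set" where
  "Omega = (SIGMA n:{1..}. n_ary n)"

definition proj :: "nat \<Rightarrow> nat \<Rightarrow> bool list \<Rightarrow> bool" where
  "proj n i = (\<lambda>xs \<in> cube n. xs ! i)"

text \<open>\<open>superpose m f gs\<close> is the \<open>m\<close>-ary function \<open>f(g\<^sub>1, \<dots>, g\<^sub>n)\<close>.\<close>

definition superpose ::
    "nat \<Rightarrow> (bool list \<Rightarrow> bool) \<Rightarrow> (bool list \<Rightarrow> bool) list \<Rightarrow> bool list \<Rightarrow> bool" where
  "superpose m f gs = (\<lambda>xs \<in> cube m. f (map (\<lambda>g. g xs) gs))"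

definition minor :: "boolfun \<Rightarrow> boolfun \<Rightarrow> bool"  (infix "\<preceq>" 50) where
  "g \<preceq> f \<longleftrightarrow>
     (\<exists>ps. length ps = fst f \<and> set ps \<subseteq> proj (fst g) ` {..<fst g} \<and>
           snd g = superpose (fst g) (snd f) ps)"

definition initial_segment :: "boolfun set \<Rightarrow> bool" where
  "initial_segment I \<longleftrightarrow> I \<subseteq> Omega \<and> (\<forall>f\<in>I. \<forall>g\<in>Omega. g \<preceq> f \<longrightarrow> g \<in> I)"

definition antichain :: "boolfun set \<Rightarrow> bool" where
  "antichain A \<longleftrightarrow> A \<subseteq> Omega \<and> (\<forall>a\<in>A. \<forall>b\<in>A. a \<noteq> b \<longrightarrow> \<not> a \<preceq> b \<and> \<not> b \<preceq> a)"

definition Forbid :: "boolfun set \<Rightarrow> boolfun set" where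
  "Forbid A = Omega - {g \<in> Omega. \<exists>a\<in>A. a \<preceq> g}"

text \<open>
  The equation
  \<open>h\<^sub>1(f(g\<^sub>1(x\<^sub>1,\<dots>,x\<^sub>p)), \<dots>, f(g\<^sub>m(x\<^sub>1,\<dots>,x\<^sub>p))) = h\<^sub>2(f(g'\<^sub>1(x\<^sub>1,\<dots>,x\<^sub>p)), \<dots>, f(g'\<^sub>t(x\<^sub>1,\<dots>,x\<^sub>p)))\<close>,
  with \<open>m\<close> and \<open>t\<close> the lengths of the lists of inner functions.
\<close>

record equation =
  num_vars :: nat
  lhs_outer :: "bool list \<Rightarrow> bool"
  lhs_inner :: "(bool list \<Rightarrow> bool) list"
  rhs_outer :: "bool list \<Rightarrow> bool"
  rhs_inner :: "(bool list \<Rightarrow> bool) list"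

definition functional_equation :: "equation \<Rightarrow> bool" where
  "functional_equation e \<longleftrightarrow>
     num_vars e \<ge> 1 \<and> length (lhs_inner e) \<ge> 1 \<and> length (rhs_inner e) \<ge> 1 \<and>
     lhs_outer e \<in> n_ary (length (lhs_inner e)) \<and> set (lhs_inner e) \<subseteq> n_ary (num_vars e) \<and>
     rhs_outer e \<in> n_ary (length (rhs_inner e)) \<and> set (rhs_inner e) \<subseteq> n_ary (num_vars e)"

text \<open>\<open>componentwise n g [v\<^sub>1, \<dots>, v\<^sub>p]\<close> is \<open>g(v\<^sub>1, \<dots>, v\<^sub>p) \<in> \<bool>^n\<close> for \<open>v\<^sub>1, \<dots>, v\<^sub>p \<in> \<bool>^n\<close>.\<close>

definition componentwise :: "nat \<Rightarrow> (bool list \<Rightarrow> bool) \<Rightarrow> bool list list \<Rightarrow> bool list" where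
  "componentwise n g vs = map (\<lambda>i. g (map (\<lambda>v. v ! i) vs)) [0..<n]"

definition satisfies :: "boolfun \<Rightarrow> equation \<Rightarrow> bool" where
  "satisfies F e \<longleftrightarrow> (case F of (n, f) \<Rightarrow>
     \<forall>vs. length vs = num_vars e \<and> set vs \<subseteq> cube n \<longrightarrow>
       lhs_outer e (map (\<lambda>g. f (componentwise n g vs)) (lhs_inner e)) =
       rhs_outer e (map (\<lambda>g. f (componentwise n g vs)) (rhs_inner e)))"

definition defined_by :: "boolfun set \<Rightarrow> equation set \<Rightarrow> bool" where
  "defined_by K E \<longleftrightarrow>
     (\<forall>e\<in>E. functional_equation e) \<and> K = {f \<in> Omega. \<forall>e\<in>E. satisfies f e}"

end

theory Submission
  imports Defs
begin

text \<open>
  For an initial segment \<open>I\<close>, each of the three conditions says that membership in \<open>I\<close> can be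
  tested on minors of bounded arity.  If an \<open>n\<close>-ary \<open>f\<close> violates an equation in \<open>p\<close> variables at
  \<open>v\<^sub>1, \<dots>, v\<^sub>p\<close>, then identifying the variables \<open>i\<close>, \<open>j\<close> of \<open>f\<close> for which the columns
  \<open>(v\<^sub>1(i), \<dots>, v\<^sub>p(i))\<close> and \<open>(v\<^sub>1(j), \<dots>, v\<^sub>p(j))\<close> agree leads to a \<open>2\<^sup>p\<close>-ary minor
  violating it.  Conversely, fix a map \<open>\<tau>\<close> from the columns in \<open>\<bool>\<^sup>N\<close> to \<open>{0,\<dots>,N-1}\<close> that sends the
  \<open>j\<close>-th unit vector to \<open>j\<close>.  With \<open>g\<^sub>x(c) = x(\<tau>(c))\<close> for \<open>x \<in> \<bool>\<^sup>N\<close>, the tuples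
  \<open>(f(g\<^sub>x(v\<^sub>1, \<dots>, v\<^sub>N)))\<^sub>x\<close> run through the value tables of all \<open>N\<close>-ary minors of \<open>f\<close>, so
  a single equation can state that none of them is the table of a function outside \<open>I\<close>.
\<close>

section \<open>Finiteness of cubes and of the sets of \<open>n\<close>-ary functions\<close>

lemma finite_cube: "finite (cube n)"
  using finite_lists_length_eq[of "UNIV :: bool set" n] by (simp add: cube_def)

lemma card_cube: "card (cube n) = 2 ^ n"
  using card_lists_length_eq[of "UNIV :: bool set" n] by (simp add: cube_def)

lemma finite_n_ary: "finite (n_ary n)"
  unfolding n_ary_def by (intro finite_PiE finite_cube) auto

section \<open>Minors as substitutions of variable indices\<close>

text \<open>A list of projections carries the same data as an index map \<open>\<sigma>\<close>, and
  extensionality makes agreement on the cube enough for equality.\<close>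

lemma minor_iff:
  assumes "g \<in> Omega"
  shows "g \<preceq> f \<longleftrightarrow> (\<exists>\<sigma>. (\<forall>i<fst f. \<sigma> i < fst g) \<and>
           (\<forall>x\<in>cube (fst g). snd g x = snd f (map (\<lambda>i. x ! \<sigma> i) [0..<fst f])))"
proof
  assume "g \<preceq> f"
  then obtain ps where ps: "length ps = fst f" "set ps \<subseteq> proj (fst g) ` {..<fst g}"
    "snd g = superpose (fst g) (snd f) ps"
    unfolding minor_def by blast
  have "\<exists>j. j < fst g \<and> ps ! i = proj (fst g) j" if "i < fst f" for i
  proof -
    have "ps ! i \<in> set ps" using that ps(1) by simp
    then show ?thesis using ps(2) by blast
  qed
  then obtain \<sigma> where \<sigma>: "\<And>i. i < fst f \<Longrightarrow> \<sigma> i < fst g \<and> ps ! i = proj (fst g) (\<sigma> i)"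
    by metis
  have "snd g x = snd f (map (\<lambda>i. x ! \<sigma> i) [0..<fst f])" if x: "x \<in> cube (fst g)" for x
  proof -
    have "map (\<lambda>h. h x) ps = map (\<lambda>i. x ! \<sigma> i) [0..<fst f]"
      using ps(1) \<sigma> x by (intro nth_equalityI) (auto simp: proj_def)
    then show ?thesis using ps(3) x by (simp add: superpose_def)
  qed
  with \<sigma> show "\<exists>\<sigma>. (\<forall>i<fst f. \<sigma> i < fst g) \<and>
      (\<forall>x\<in>cube (fst g). snd g x = snd f (map (\<lambda>i. x ! \<sigma> i) [0..<fst f]))"
    by blast
next
  assume "\<exists>\<sigma>. (\<forall>i<fst f. \<sigma> i < fst g) \<and>
    (\<forall>x\<in>cube (fst g). snd g x = snd f (map (\<lambda>i. x ! \<sigma> i) [0..<fst f]))"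
  then obtain \<sigma> where \<sigma>: "\<And>i. i < fst f \<Longrightarrow> \<sigma> i < fst g"
    "\<And>x. x \<in> cube (fst g) \<Longrightarrow> snd g x = snd f (map (\<lambda>i. x ! \<sigma> i) [0..<fst f])"
    by blast
  define ps where "ps = map (\<lambda>i. proj (fst g) (\<sigma> i)) [0..<fst f]"
  have "snd g x = superpose (fst g) (snd f) ps x" for x
  proof (cases "x \<in> cube (fst g)")
    case True
    then have "map (\<lambda>h. h x) ps = map (\<lambda>i. x ! \<sigma> i) [0..<fst f]"
      by (simp add: ps_def proj_def)
    then show ?thesis using True \<sigma>(2) by (simp add: superpose_def)
  next
    case False
    then show ?thesis using assms by (auto simp: Omega_def n_ary_def superpose_def)
  qed
  moreover have "length ps = fst f" "set ps \<subseteq> proj (fst g) ` {..<fst g}"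
    using \<sigma>(1) by (auto simp: ps_def)
  ultimately show "g \<preceq> f" unfolding minor_def by blast
qed

definition substitute :: "nat \<Rightarrow> (nat \<Rightarrow> nat) \<Rightarrow> boolfun \<Rightarrow> boolfun" where
  "substitute m \<sigma> f = (m, \<lambda>x\<in>cube m. snd f (map (\<lambda>i. x ! \<sigma> i) [0..<fst f]))"

lemma substitute_Omega: "m \<ge> 1 \<Longrightarrow> substitute m \<sigma> f \<in> Omega"
  by (auto simp: substitute_def Omega_def n_ary_def)

lemma fst_substitute [simp]: "fst (substitute m \<sigma> f) = m"
  by (simp add: substitute_def)

lemma substitute_apply:
  "x \<in> cube m \<Longrightarrow> snd (substitute m \<sigma> f) x = snd f (map (\<lambda>i. x ! \<sigma> i) [0..<fst f])"
  by (simp add: substitute_def)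

lemma substitute_minor:
  assumes "m \<ge> 1" "\<And>i. i < fst f \<Longrightarrow> \<sigma> i < m"
  shows "substitute m \<sigma> f \<preceq> f"
  unfolding minor_iff[OF substitute_Omega[OF assms(1)]]
  using assms(2) by (auto simp: substitute_apply)

lemma minor_refl:
  assumes "f \<in> Omega"
  shows "f \<preceq> f"
  unfolding minor_iff[OF assms]
proof (intro exI[of _ "\<lambda>i. i"] conjI ballI allI impI)
  fix x :: "bool list" assume "x \<in> cube (fst f)"
  then have "map (\<lambda>i. x ! i) [0..<fst f] = x" by (metis cube_def map_nth mem_Collect_eq)
  then show "snd f x = snd f (map (\<lambda>i. x ! i) [0..<fst f])" by simp
qed

lemma minor_trans:
  assumes "f \<in> Omega" "g \<in> Omega" "f \<preceq> g" "g \<preceq> h"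
  shows "f \<preceq> h"
proof -
  obtain \<sigma> where \<sigma>: "\<And>i. i < fst g \<Longrightarrow> \<sigma> i < fst f"
    "\<And>x. x \<in> cube (fst f) \<Longrightarrow> snd f x = snd g (map (\<lambda>i. x ! \<sigma> i) [0..<fst g])"
    using assms(3) unfolding minor_iff[OF assms(1)] by blast
  obtain \<tau> where \<tau>: "\<And>i. i < fst h \<Longrightarrow> \<tau> i < fst g"
    "\<And>x. x \<in> cube (fst g) \<Longrightarrow> snd g x = snd h (map (\<lambda>i. x ! \<tau> i) [0..<fst h])"
    using assms(4) unfolding minor_iff[OF assms(2)] by blast
  have "snd f x = snd h (map (\<lambda>i. x ! \<sigma> (\<tau> i)) [0..<fst h])" if x: "x \<in> cube (fst f)" for x
  proof -
    let ?y = "map (\<lambda>i. x ! \<sigma> i) [0..<fst g]"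
    have "snd f x = snd h (map (\<lambda>i. ?y ! \<tau> i) [0..<fst h])"
      using \<sigma>(2)[OF x] \<tau>(2)[of ?y] by (simp add: cube_def)
    also have "map (\<lambda>i. ?y ! \<tau> i) [0..<fst h] = map (\<lambda>i. x ! \<sigma> (\<tau> i)) [0..<fst h]"
      using \<tau>(1) by simp
    finally show ?thesis .
  qed
  then show ?thesis
    unfolding minor_iff[OF assms(1)] using \<sigma>(1) \<tau>(1) by (intro exI[of _ "\<sigma> \<circ> \<tau>"]) auto
qed

text \<open>Fictitious variables raise the arity, and identifying them with an old variable undoes
  this. Non-members of arity at most \<open>N\<close> can thus be replaced by ones of arity exactly
  \<open>N\<close>, whose value tables have a common length.\<close>

lemma minor_equivalent_of_larger_arity:
  assumes "g \<in> Omega" "fst g \<le> N"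
  obtains g' where "g' \<in> Omega" "fst g' = N" "g' \<preceq> g" "g \<preceq> g'"
proof
  have m: "1 \<le> fst g" using assms(1) by (auto simp: Omega_def)
  let ?g' = "substitute N (\<lambda>i. i) g"
  show "?g' \<in> Omega" "fst ?g' = N" "?g' \<preceq> g"
    using m assms(2) by (auto intro!: substitute_Omega substitute_minor)
  \<comment> \<open>Each added variable is identified with variable 0, which exists because
    \<open>fst g\<close> is at least 1.\<close>
  let ?\<sigma> = "\<lambda>i. if i < fst g then i else 0"
  have "snd g x = snd ?g' (map (\<lambda>i. x ! ?\<sigma> i) [0..<N])" if x: "x \<in> cube (fst g)" for x
  proof -
    have "map (\<lambda>i. map (\<lambda>i. x ! ?\<sigma> i) [0..<N] ! i) [0..<fst g] = x"
      using x assms(2) by (intro nth_equalityI) (auto simp: cube_def)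
    then show ?thesis by (subst substitute_apply) (auto simp: cube_def)
  qed
  then show "g \<preceq> ?g'"
    unfolding minor_iff[OF assms(1)] using m by (intro exI[of _ ?\<sigma>]) auto
qed

section \<open>Testing membership on minors of bounded arity\<close>

text \<open>In an initial segment a minor outside \<open>I\<close> already forces \<open>f\<close>
  outside \<open>I\<close>, so only the reverse has to be demanded.\<close>

definition determined_by_arity :: "nat \<Rightarrow> boolfun set \<Rightarrow> bool" where
  "determined_by_arity N I \<longleftrightarrow>
     (\<forall>f\<in>Omega - I. \<exists>g\<in>Omega - I. fst g \<le> N \<and> g \<preceq> f)"

lemma determined_by_arity_mono:
  "determined_by_arity M I \<Longrightarrow> M \<le> N \<Longrightarrow> determined_by_arity N I"
  unfolding determined_by_arity_def by (meson order_trans)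

lemma violating_minor:
  assumes "functional_equation e" "f \<in> Omega" "\<not> satisfies f e"
  obtains g where "g \<in> Omega" "fst g = 2 ^ num_vars e" "g \<preceq> f" "\<not> satisfies g e"
proof -
  define p n where "p = num_vars e" and "n = fst f"
  obtain vs where vs: "length vs = p" "set vs \<subseteq> cube n"
    "lhs_outer e (map (\<lambda>h. snd f (componentwise n h vs)) (lhs_inner e)) \<noteq>
     rhs_outer e (map (\<lambda>h. snd f (componentwise n h vs)) (rhs_inner e))"
    using assms(3) by (auto simp: satisfies_def p_def n_def case_prod_unfold)
  \<comment> \<open>\<open>cs\<close> numbers all \<open>2 ^ p\<close> possible columns. Below,
    \<open>\<sigma> i\<close> is the number of the column of \<open>vs\<close> at \<open>i\<close>,
    so positions with equal columns are identified.\<close>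
  obtain cs where cs: "set cs = cube p" "distinct cs"
    using finite_distinct_list[OF finite_cube] by blast
  have len: "length cs = 2 ^ p" using distinct_card[OF cs(2)] cs(1) card_cube by simp
  have "\<exists>j. j < 2 ^ p \<and> cs ! j = map (\<lambda>v. v ! i) vs" for i
  proof -
    have "map (\<lambda>v. v ! i) vs \<in> set cs" using cs(1) vs(1) by (simp add: cube_def)
    then show ?thesis using len by (metis in_set_conv_nth)
  qed
  then obtain \<sigma> where \<sigma>: "\<And>i. \<sigma> i < 2 ^ p" "\<And>i. cs ! \<sigma> i = map (\<lambda>v. v ! i) vs"
    by metis
  define g where "g = substitute (2 ^ p) \<sigma> f"
  \<comment> \<open>Transposition: \<open>ws\<close> has \<open>p\<close> rows, and its column at
    \<open>j\<close> is \<open>cs ! j\<close>.\<close>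
  define ws where "ws = map (\<lambda>k. map (\<lambda>c. c ! k) cs) [0..<p]"
  have ws: "length ws = p" "set ws \<subseteq> cube (2 ^ p)"
    using len by (auto simp: ws_def cube_def)
  have col: "map (\<lambda>w. w ! j) ws = cs ! j" if "j < 2 ^ p" for j
  proof -
    have "length (cs ! j) = p" using that len cs(1) nth_mem[of j cs] by (simp add: cube_def)
    then show ?thesis using that len by (intro nth_equalityI) (auto simp: ws_def)
  qed
  \<comment> \<open>The column of \<open>ws\<close> at \<open>\<sigma> i\<close> is the column of
    \<open>vs\<close> at \<open>i\<close>, so every value of \<open>g\<close> entering the equation
    at \<open>ws\<close> is the corresponding value of \<open>f\<close> at
    \<open>vs\<close>.\<close>
  have eq: "snd g (componentwise (2 ^ p) h ws) = snd f (componentwise n h vs)" for h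
  proof -
    have "componentwise (2 ^ p) h ws \<in> cube (2 ^ p)" by (simp add: componentwise_def cube_def)
    then have "snd g (componentwise (2 ^ p) h ws) =
        snd f (map (\<lambda>i. componentwise (2 ^ p) h ws ! \<sigma> i) [0..<n])"
      unfolding g_def n_def by (rule substitute_apply)
    also have "map (\<lambda>i. componentwise (2 ^ p) h ws ! \<sigma> i) [0..<n] = componentwise n h vs"
      using \<sigma> col by (simp add: componentwise_def)
    finally show ?thesis .
  qed
  have "lhs_outer e (map (\<lambda>h. snd g (componentwise (fst g) h ws)) (lhs_inner e)) \<noteq>
        rhs_outer e (map (\<lambda>h. snd g (componentwise (fst g) h ws)) (rhs_inner e))"
    using vs(3) eq by (simp add: g_def)
  moreover have "length ws = num_vars e" "set ws \<subseteq> cube (fst g)"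
    using ws by (simp_all add: g_def p_def)
  ultimately have "\<not> satisfies g e"
    by (auto simp: satisfies_def case_prod_unfold)
  moreover have "g \<in> Omega" "fst g = 2 ^ num_vars e" "g \<preceq> f"
    using \<sigma>(1) by (auto simp: g_def p_def intro!: substitute_Omega substitute_minor)
  ultimately show ?thesis using that by blast
qed

lemma determined_by_arity_if_defined_by:
  assumes "finite E" "defined_by I E"
  shows "\<exists>N. determined_by_arity N I"
proof (intro exI)
  \<comment> \<open>A sum bounds each of its terms and, unlike a maximum, needs no separate case for
    empty \<open>E\<close>.\<close>
  let ?N = "\<Sum>e\<in>E. 2 ^ num_vars e :: nat"
  show "determined_by_arity ?N I"
    unfolding determined_by_arity_def
  proof
    fix f assume f: "f \<in> Omega - I"
    then obtain e where e: "e \<in> E" "functional_equation e" "\<not> satisfies f e"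
      using assms(2) by (auto simp: defined_by_def)
    then obtain g where g: "g \<in> Omega" "fst g = 2 ^ num_vars e" "g \<preceq> f" "\<not> satisfies g e"
      using violating_minor f by blast
    have "fst g \<le> ?N"
      unfolding g(2) using e(1) assms(1) by (intro member_le_sum) auto
    moreover have "g \<notin> I" using assms(2) g e(1) by (auto simp: defined_by_def)
    ultimately show "\<exists>g\<in>Omega - I. fst g \<le> ?N \<and> g \<preceq> f" using g by blast
  qed
qed

text \<open>A function outside \<open>Forbid A\<close> lies above some \<open>a\<close> in
  \<open>A\<close>, and \<open>a\<close> is itself a non-member by reflexivity.\<close>

lemma determined_by_arity_Forbid:
  assumes "finite A" "A \<subseteq> Omega"
  shows "\<exists>N. determined_by_arity N (Forbid A)"
proof (intro exI)
  show "determined_by_arity (\<Sum>a\<in>A. fst a) (Forbid A)"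
    unfolding determined_by_arity_def
  proof
    fix f assume "f \<in> Omega - Forbid A"
    then obtain a where a: "a \<in> A" "a \<preceq> f" by (auto simp: Forbid_def)
    then have "a \<in> Omega - Forbid A"
      using assms(2) minor_refl[of a] by (auto simp: Forbid_def)
    moreover have "fst a \<le> (\<Sum>a\<in>A. fst a)" using a(1) assms(1) by (intro member_le_sum) auto
    ultimately show "\<exists>g\<in>Omega - Forbid A. fst g \<le> (\<Sum>a\<in>A. fst a) \<and> g \<preceq> f"
      using a(2) by blast
  qed
qed

section \<open>Finite antichains of forbidden functions\<close>

text \<open>Elements are added one at a time: a new \<open>b\<close> is dropped if some element of
  \<open>A\<close> lies below it, and otherwise displaces all elements of \<open>A\<close> above
  it.\<close>

lemma finite_coinitial_antichain:
  assumes "finite B" "B \<subseteq> Omega"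
  shows "\<exists>A\<subseteq>B. antichain A \<and> (\<forall>b\<in>B. \<exists>a\<in>A. a \<preceq> b)"
  using assms
proof (induction rule: finite_induct)
  case empty
  then show ?case by (auto simp: antichain_def)
next
  case (insert b B)
  then obtain A where A: "A \<subseteq> B" "antichain A" "\<And>c. c \<in> B \<Longrightarrow> \<exists>a\<in>A. a \<preceq> c" by auto
  have Om: "b \<in> Omega" "B \<subseteq> Omega" using insert.prems by auto
  show ?case
  proof (cases "\<exists>a\<in>A. a \<preceq> b")
    case True
    then show ?thesis using A by (intro exI[of _ A]) auto
  next
    case False
    let ?A = "insert b {a \<in> A. \<not> b \<preceq> a}"
    have "antichain ?A" using A(2) False Om(1) by (auto simp: antichain_def)
    moreover have "\<exists>a\<in>?A. a \<preceq> c" if c: "c \<in> insert b B" for c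
    proof (cases "c = b")
      case True
      then show ?thesis using minor_refl Om(1) by auto
    next
      case False
      then obtain a where a: "a \<in> A" "a \<preceq> c" using c A(3) by blast
      show ?thesis
      \<comment> \<open>If \<open>a\<close> was displaced, transitivity lets \<open>b\<close> take
        its place below \<open>c\<close>.\<close>
      proof (cases "b \<preceq> a")
        case True
        moreover have "a \<in> Omega" using a(1) A(1) Om(2) by auto
        ultimately have "b \<preceq> c" using minor_trans[of b a c] Om(1) a(2) by blast
        then show ?thesis by blast
      qed (use a in blast)
    qed
    ultimately show ?thesis using A(1) by (intro exI[of _ ?A]) auto
  qed
qed

text \<open>Only finitely many functions have arity at most \<open>N\<close>, so the non-members
  among them contain a finite antichain that lies below all of them, and hence below every
  non-member.\<close>

lemma Forbid_if_determined_by_arity: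
  assumes I: "initial_segment I" and N: "determined_by_arity N I"
  shows "\<exists>A. finite A \<and> antichain A \<and> I = Forbid A"
proof -
  let ?B = "{g \<in> Omega - I. fst g \<le> N}"
  have fin: "finite ?B"
  proof (rule finite_subset)
    show "?B \<subseteq> (SIGMA n:{..N}. n_ary n)" by (auto simp: Omega_def)
    show "finite (SIGMA n:{..N}. n_ary n)" by (intro finite_SigmaI finite_n_ary) auto
  qed
  then obtain A where A: "A \<subseteq> ?B" "antichain A" "\<And>b. b \<in> ?B \<Longrightarrow> \<exists>a\<in>A. a \<preceq> b"
    using finite_coinitial_antichain[of ?B] by auto
  have "I = Forbid A"
  proof
    show "I \<subseteq> Forbid A"
      using I A(1) by (fastforce simp: Forbid_def initial_segment_def)
    show "Forbid A \<subseteq> I"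
    proof (rule ccontr)
      assume "\<not> Forbid A \<subseteq> I"
      then obtain f where f: "f \<in> Forbid A" "f \<in> Omega - I" by (auto simp: Forbid_def)
      then obtain g where g: "g \<in> ?B" "g \<preceq> f"
        using N unfolding determined_by_arity_def by blast
      then obtain a where a: "a \<in> A" "a \<preceq> g" using A(3) by blast
      then have "a \<preceq> f" using minor_trans[of a g f] g A(1) by blast
      then show False using f a(1) by (auto simp: Forbid_def)
    qed
  qed
  then show ?thesis using A fin finite_subset by blast
qed

section \<open>Encoding an initial segment in one equation\<close>

lemma single_equation_if_determined_by_arity:
  assumes I: "initial_segment I" and N: "determined_by_arity N I" and N1: "N \<ge> 1"
  shows "\<exists>e. defined_by I {e}"
proof -
  \<comment> \<open>With this fixed enumeration of the cube, \<open>map (snd a) xs\<close> is the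
    value table of \<open>a\<close>; repetitions in \<open>xs\<close> do no harm.\<close>
  obtain xs where xs: "set xs = cube N" using finite_list[OF finite_cube] by blast
  have xs_ne: "length xs \<ge> 1"
  proof -
    have "replicate N False \<in> set xs" using xs by (simp add: cube_def)
    then show ?thesis by (cases xs) auto
  qed
  \<comment> \<open>\<open>\<tau>\<close> picks the first true coordinate, with default 0 for the
    zero column. What counts is that it stays below \<open>N\<close> and sends unit vectors to their
    index.\<close>
  define \<tau> :: "bool list \<Rightarrow> nat" where
    "\<tau> c = (if \<exists>j<N. c ! j then LEAST j. c ! j else 0)" for c
  have \<tau>_less: "\<tau> c < N" for c
  proof (cases "\<exists>j<N. c ! j")
    case True
    then obtain j where j: "j < N" "c ! j" by blast
    have "(LEAST j. c ! j) \<le> j" using j(2) by (rule Least_le)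
    then show ?thesis using True j(1) by (simp add: \<tau>_def)
  next
    case False
    then have "\<tau> c = 0" unfolding \<tau>_def by (rule if_not_P)
    then show ?thesis using N1 by simp
  qed
  have \<tau>_unit: "\<tau> (map (\<lambda>k. j = k) [0..<N]) = j" if "j < N" for j
  proof -
    let ?c = "map (\<lambda>k. j = k) [0..<N]"
    have "(LEAST k. ?c ! k) = j"
    proof (rule Least_equality)
      show "?c ! j" using that by simp
      fix k assume "?c ! k"
      then show "j \<le> k" using that by (cases "k < N") auto
    qed
    moreover have "\<exists>k<N. ?c ! k" using that by (intro exI[of _ j]) simp
    ultimately show ?thesis unfolding \<tau>_def by argo
  qed
  define G :: "bool list \<Rightarrow> bool list \<Rightarrow> bool" where "G x = (\<lambda>c\<in>cube N. x ! \<tau> c)" for x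
  \<comment> \<open>\<open>h\<close> recognises the value tables of \<open>N\<close>-ary
    non-members, and \<open>e\<close> says that it is never true. The right side is constantly
    \<open>False\<close>, with one dummy inner function because each side must have one.\<close>
  define h where "h = (\<lambda>y\<in>cube (length xs). \<exists>a\<in>Omega - I. fst a = N \<and> y = map (snd a) xs)"
  define e where "e = \<lparr>num_vars = N, lhs_outer = h, lhs_inner = map G xs,
    rhs_outer = (\<lambda>y\<in>cube 1. False), rhs_inner = [\<lambda>c\<in>cube N. False]\<rparr>"
  have fe: "functional_equation e"
    using N1 xs_ne by (auto simp: functional_equation_def e_def h_def G_def n_ary_def)
  define M where "M f vs = substitute N (\<lambda>i. \<tau> (map (\<lambda>v. v ! i) vs)) f"
    for f :: boolfun and vs :: "bool list list"
  have M_Omega: "M f vs \<in> Omega" and M_minor: "M f vs \<preceq> f" for f vs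
    unfolding M_def using N1 \<tau>_less by (auto intro!: substitute_Omega substitute_minor)
  have M_apply: "snd f (componentwise (fst f) (G x) vs) = snd (M f vs) x"
    if "length vs = N" "x \<in> cube N" for f vs x
    using that by (simp add: M_def substitute_apply componentwise_def G_def cube_def)
  have table_eq: "M f vs = a"
    if "a \<in> Omega" "fst a = N" "map (snd (M f vs)) xs = map (snd a) xs" for f vs a
  proof -
    have "snd (M f vs) x = snd a x" for x
    proof (cases "x \<in> cube N")
      case True
      then show ?thesis using that(3) xs by auto
    next
      case False
      then show ?thesis
        using that(1,2) M_Omega[of f vs] by (auto simp: M_def substitute_def Omega_def n_ary_def)
    qed
    then show ?thesis using that(2) by (intro prod_eqI) (auto simp: M_def)
  qed
  \<comment> \<open>The arguments of \<open>h\<close> at \<open>vs\<close> form the value table of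
    \<open>M f vs\<close>, and a table determines its \<open>N\<close>-ary function.\<close>
  have sat: "satisfies f e \<longleftrightarrow> (\<forall>vs. length vs = N \<and> set vs \<subseteq> cube (fst f) \<longrightarrow> M f vs \<in> I)" for f
  proof -
    have "(h (map (\<lambda>g. snd f (componentwise (fst f) g vs)) (map G xs)) = False) \<longleftrightarrow> M f vs \<in> I"
      if "length vs = N" for vs
    proof -
      have "map (\<lambda>g. snd f (componentwise (fst f) g vs)) (map G xs) = map (snd (M f vs)) xs"
        using M_apply[OF that] xs by auto
      then have "h (map (\<lambda>g. snd f (componentwise (fst f) g vs)) (map G xs)) \<longleftrightarrow>
          (\<exists>a\<in>Omega - I. fst a = N \<and> map (snd (M f vs)) xs = map (snd a) xs)"
        by (simp add: h_def cube_def)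
      also have "\<dots> \<longleftrightarrow> M f vs \<notin> I"
      proof
        assume "\<exists>a\<in>Omega - I. fst a = N \<and> map (snd (M f vs)) xs = map (snd a) xs"
        then show "M f vs \<notin> I" using table_eq by blast
      next
        assume "M f vs \<notin> I"
        then show "\<exists>a\<in>Omega - I. fst a = N \<and> map (snd (M f vs)) xs = map (snd a) xs"
          using M_Omega by (intro bexI[of _ "M f vs"]) (auto simp: M_def)
      qed
      finally show ?thesis by simp
    qed
    then show ?thesis
      by (auto simp: satisfies_def e_def case_prod_unfold cube_def)
  qed
  have "I = {f \<in> Omega. satisfies f e}"
  proof (intro equalityI subsetI CollectI conjI)
    fix f assume f: "f \<in> I"
    then show "f \<in> Omega" using I by (auto simp: initial_segment_def)
    show "satisfies f e"
      unfolding sat using f I M_Omega M_minor by (auto simp: initial_segment_def)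
  next
    fix f assume f: "f \<in> {f \<in> Omega. satisfies f e}"
    show "f \<in> I"
    proof (rule ccontr)
      assume "f \<notin> I"
      then obtain g0 where g0: "g0 \<in> Omega - I" "fst g0 \<le> N" "g0 \<preceq> f"
        using f N unfolding determined_by_arity_def by blast
      then obtain g where g: "g \<in> Omega" "fst g = N" "g \<preceq> g0" "g0 \<preceq> g"
        using minor_equivalent_of_larger_arity by blast
      \<comment> \<open>Otherwise \<open>g0\<close>, being a minor of \<open>g\<close>, would lie in
        \<open>I\<close>.\<close>
      have "g \<notin> I" using g g0 I by (auto simp: initial_segment_def)
      have "g \<preceq> f" using minor_trans g g0 by blast
      then obtain \<sigma> where \<sigma>: "\<And>i. i < fst f \<Longrightarrow> \<sigma> i < N"
        "\<And>x. x \<in> cube N \<Longrightarrow> snd g x = snd f (map (\<lambda>i. x ! \<sigma> i) [0..<fst f])"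
        unfolding minor_iff[OF g(1)] g(2) by blast
      \<comment> \<open>The column of \<open>vs\<close> at \<open>i\<close> is the unit vector of
        index \<open>\<sigma> i\<close>, which \<open>\<tau>\<close> sends back to
        \<open>\<sigma> i\<close>; so \<open>M f vs\<close> is exactly the forbidden minor
        \<open>g\<close>.\<close>
      define vs where "vs = map (\<lambda>k. map (\<lambda>i. \<sigma> i = k) [0..<fst f]) [0..<N]"
      have vs: "length vs = N" "set vs \<subseteq> cube (fst f)" by (auto simp: vs_def cube_def)
      have col: "\<tau> (map (\<lambda>v. v ! i) vs) = \<sigma> i" if "i < fst f" for i
        using \<tau>_unit[OF \<sigma>(1)[OF that]] that by (simp add: vs_def comp_def)
      have "snd (M f vs) x = snd g x" if "x \<in> cube N" for x
      proof -
        have "map (\<lambda>i. x ! \<tau> (map (\<lambda>v. v ! i) vs)) [0..<fst f] = map (\<lambda>i. x ! \<sigma> i) [0..<fst f]"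
          using col by (intro map_cong) auto
        then show ?thesis using \<sigma>(2)[OF that] that by (simp only: M_def substitute_apply)
      qed
      then have "M f vs = g" using table_eq[OF g(1,2)] xs by simp
      then show False using f vs \<open>g \<notin> I\<close> unfolding sat by blast
    qed
  qed
  then show ?thesis using fe by (auto simp: defined_by_def)
qed

theorem mainTheorem1:
  fixes I :: "boolfun set"
  assumes "initial_segment I"
  shows "((\<exists>E. finite E \<and> defined_by I E) \<longleftrightarrow> (\<exists>e. defined_by I {e})) \<and>
         ((\<exists>e. defined_by I {e}) \<longleftrightarrow> (\<exists>A. finite A \<and> antichain A \<and> I = Forbid A))"
proof -
  have "\<exists>e. defined_by I {e}" if "\<exists>N. determined_by_arity N I"
  proof -
    from that obtain N where "determined_by_arity N I" ..
    \<comment> \<open>An equation has at least one variable, so a bound of 0 is raised to 1.\<close>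
    then have "determined_by_arity (max N 1) I"
      by (rule determined_by_arity_mono) simp
    then show ?thesis by (rule single_equation_if_determined_by_arity[OF assms]) simp
  qed
  moreover have "\<exists>N. determined_by_arity N I" if "\<exists>A. finite A \<and> antichain A \<and> I = Forbid A"
  proof -
    from that obtain A where "finite A" "A \<subseteq> Omega" "I = Forbid A"
      unfolding antichain_def by blast
    then show ?thesis using determined_by_arity_Forbid by simp
  qed
  moreover have "\<exists>N. determined_by_arity N I" if "\<exists>E. finite E \<and> defined_by I E"
    using that by (elim exE conjE) (rule determined_by_arity_if_defined_by)
  moreover have "\<exists>E. finite E \<and> defined_by I E" if "\<exists>e. defined_by I {e}"
    using that by (meson finite.emptyI finite.insertI)
  moreover have "\<exists>A. finite A \<and> antichain A \<and> I = Forbid A" if "\<exists>N. determined_by_arity N I"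
    using that by (elim exE) (rule Forbid_if_determined_by_arity[OF assms])
  \<comment> \<open>Bounded determination is the hub: (i) and (iii) each imply it, it implies (ii)
    and (iii), and (ii) is a case of (i).\<close>
  ultimately show ?thesis by argo
qed

end
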